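(* For every $n\ge2$, the polynomials $DR_{n,0},DR_{n,2},DR_{n,3},\dots,DR_{n,n}\in k[V_n\times V_{n-2}]$ are algebraically independent over $k$.
   Context: Let $k$ be a field of characteristic zero and $V_m=k[x,y]_m$ the space of binary forms of degree $m$; $k[V_n\times V_{n-2}]$ is the polynomial ring in the coefficients of a generic $f\in V_n$ and a generic $g\in V_{n-2}$. For pairs $\sigma=(\sigma_0,\sigma_1)$, $\tau=(\tau_0,\tau_1)$, $[\sigma,\tau]:=\sigma_0\tau_1-\tau_0\sigma_1$. Resultant convention: if $f=\prod_{i=1}^d(\gamma_{i,0}x-\gamma_{i,1}y)$ and $g=\prod_{j=1}^e(\delta_{j,0}x-\delta_{j,1}y)$, then $\mathrm{res}(f,g)=\prod_{i,j}[\gamma_i,\delta_j]$, a polynomial in the coefficients. Discriminant-resultants: writing $f=\sum_{i=0}^n a_ix^iy^{n-i}$, the polynomials $DR_{n,r}(f,g)$, $0\le r\le n$, are defined by $\sum_{r=0}^n DR_{n,r}(f,g)t^r=\mathrm{res}(f,\,x\partial_xf+t\,xy\,g)/(a_0a_n)$, with $t$ an indeterminate and the division exact. ($DR_{n,0}$ is the discriminant of $f$ and $DR_{n,n}=\mathrm{res}(f,g)$.) *)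

theory Defs
  imports "HOL-Library.Poly_Mapping" "HOL-Computational_Algebra.Polynomial"
    "Jordan_Normal_Form.Determinant"
begin

text \<open>Multivariate polynomials over a coefficient ring: finitely supported maps
  from monomials (finitely supported exponent vectors) to coefficients.
  The convolution product of Poly_Mapping makes this the polynomial ring.\<close>
type_synonym 'a mpoly = "(nat \<Rightarrow>\<^sub>0 nat) \<Rightarrow>\<^sub>0 'a"

definition mVar :: "nat \<Rightarrow> 'a::comm_ring_1 mpoly" where
  "mVar i = Poly_Mapping.single (Poly_Mapping.single i 1) 1"

definition mConst :: "'a::comm_ring_1 \<Rightarrow> 'a mpoly" where
  "mConst c = Poly_Mapping.single 0 c"

definition mpoly_subst :: "(nat \<Rightarrow> 'a::comm_ring_1 mpoly) \<Rightarrow> 'a mpoly \<Rightarrow> 'a mpoly" where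
  "mpoly_subst \<sigma> P =
     (\<Sum>m\<in>Poly_Mapping.keys P. mConst (Poly_Mapping.lookup P m) * (\<Prod>i\<in>Poly_Mapping.keys m. \<sigma> i ^ Poly_Mapping.lookup m i))"

definition alg_indep :: "(nat \<Rightarrow> 'a::comm_ring_1 mpoly) \<Rightarrow> nat \<Rightarrow> bool" where
  "alg_indep q N \<longleftrightarrow>
     (\<forall>P :: 'a mpoly. (\<forall>m\<in>Poly_Mapping.keys P. Poly_Mapping.keys m \<subseteq> {..<N}) \<longrightarrow> mpoly_subst q P = 0 \<longrightarrow> P = 0)"

text \<open>Sylvester matrix of binary forms p (degree d) and q (degree e), given by
  coefficient functions: p k is the coefficient of x^k y^(d-k). With this
  ordering, det gives exactly res(f,g) = prod [gamma_i, delta_j].\<close>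
definition sylvester :: "nat \<Rightarrow> nat \<Rightarrow> (nat \<Rightarrow> 'r::comm_ring_1) \<Rightarrow> (nat \<Rightarrow> 'r) \<Rightarrow> 'r mat" where
  "sylvester d e p q = mat (d + e) (d + e) (\<lambda>(i, j).
     if i < e then (if i \<le> j \<and> j - i \<le> d then p (j - i) else 0)
     else (if i - e \<le> j \<and> j - (i - e) \<le> e then q (j - (i - e)) else 0))"

definition bin_res :: "nat \<Rightarrow> nat \<Rightarrow> (nat \<Rightarrow> 'r::comm_ring_1) \<Rightarrow> (nat \<Rightarrow> 'r) \<Rightarrow> 'r" where
  "bin_res d e p q = det (sylvester d e p q)"

text \<open>Generic f in V_n: coefficient a_i = mVar i (i = 0..n), f = sum a_i x^i y^(n-i).
  Generic g in V_(n-2): coefficient b_j = mVar (n+1+j) (j = 0..n-2).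
  Coefficients of x d/dx f + t x y g as polynomials in t.\<close>
definition DR_f :: "nat \<Rightarrow> nat \<Rightarrow> 'a::comm_ring_1 mpoly poly" where
  "DR_f n i = [: mVar i :]"

definition DR_h :: "nat \<Rightarrow> nat \<Rightarrow> 'a::comm_ring_1 mpoly poly" where
  "DR_h n i = [: of_nat i * mVar i,
                 (if 1 \<le> i \<and> i \<le> n - 1 then mVar (n + 1 + (i - 1)) else 0) :]"

definition DR_res :: "nat \<Rightarrow> 'a::comm_ring_1 mpoly poly" where
  "DR_res n = bin_res n n (DR_f n) (DR_h n)"

definition DR :: "nat \<Rightarrow> nat \<Rightarrow> 'a::comm_ring_1 mpoly" where
  "DR n r = (THE q. coeff (DR_res n) r = mVar 0 * mVar n * q)"

end

theory Submission
  imports Defs "Jordan_Normal_Form.Char_Poly" "HOL-Algebra.Algebraic_Closure_Type"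
begin

text \<open>
  Dehomogenise by \<open>y = 1\<close>. At the roots \<open>\<alpha>\<^sub>i\<close> of \<open>f\<close> one has
  \<open>x f' + t x g = \<alpha>\<^sub>i f'(\<alpha>\<^sub>i) (1 + t c\<^sub>i)\<close> with \<open>c\<^sub>i = g(\<alpha>\<^sub>i) / f'(\<alpha>\<^sub>i)\<close>, so that
  \<open>DR\<^sub>r = DR\<^sub>0 e\<^sub>r(c)\<close>. If \<open>a\<^bsub>n-1\<^esub> = 0\<close>, then \<open>g = - \<partial>\<^sub>y f / y\<close> is a form of degree \<open>n - 2\<close>
  for which \<open>c\<^sub>i = \<alpha>\<^sub>i\<close>, hence \<open>DR\<^sub>r = (-1)\<^sup>r DR\<^sub>0 a\<^bsub>n-r\<^esub> / a\<^sub>n\<close>. Over an algebraically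
  closed field, rescaling \<open>f\<close> adjusts \<open>DR\<^sub>0\<close> freely, so every point outside the zero set of one
  nonzero polynomial \<open>Q\<close> is a value of \<open>(DR\<^sub>0, DR\<^sub>2, \<dots>, DR\<^sub>n)\<close>. A polynomial relation \<open>P\<close> would
  vanish at all of these, whereas \<open>P Q \<noteq> 0\<close> has a nonzero value somewhere.
\<close>

hide_const (open) up_ring.coeff up_ring.monom Polynomials.degree Polynomials.lead_coeff

subsection \<open>Evaluation of multivariate polynomials\<close>

definition mon_eval :: "(nat \<Rightarrow> 'b::comm_ring_1) \<Rightarrow> (nat \<Rightarrow>\<^sub>0 nat) \<Rightarrow> 'b" where
  "mon_eval v m = (\<Prod>i\<in>Poly_Mapping.keys m. v i ^ Poly_Mapping.lookup m i)"

text \<open>The coefficient map \<open>h\<close> lets one notion cover substitution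
  (\<open>mConst\<close>), values in the field (\<open>id\<close>), values in its algebraic closure
  (\<open>to_ac\<close>) and the passage to one variable (\<open>[:c:]\<close>).\<close>

definition meval :: "('a::comm_ring_1 \<Rightarrow> 'b::comm_ring_1) \<Rightarrow> (nat \<Rightarrow> 'b) \<Rightarrow> 'a mpoly \<Rightarrow> 'b" where
  "meval h v P = (\<Sum>m\<in>Poly_Mapping.keys P. h (Poly_Mapping.lookup P m) * mon_eval v m)"

lemma mpoly_subst_eq_meval: "mpoly_subst q = meval mConst q"
  by (simp add: fun_eq_iff mpoly_subst_def meval_def mon_eval_def)

lemma mon_eval_superset:
  assumes "finite A" "Poly_Mapping.keys m \<subseteq> A"
  shows "mon_eval v m = (\<Prod>i\<in>A. v i ^ Poly_Mapping.lookup m i)"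
  unfolding mon_eval_def using assms
  by (intro prod.mono_neutral_left) (auto simp: in_keys_iff)

lemma mon_eval_0 [simp]: "mon_eval v 0 = 1"
  by (simp add: mon_eval_def)

lemma mon_eval_add: "mon_eval v (m + m') = mon_eval v m * mon_eval v m'"
proof -
  let ?A = "Poly_Mapping.keys m \<union> Poly_Mapping.keys m'"
  have "mon_eval v (m + m') = (\<Prod>i\<in>?A. v i ^ Poly_Mapping.lookup (m + m') i)"
    by (rule mon_eval_superset) (auto simp: in_keys_iff lookup_add)
  also have "\<dots> = mon_eval v m * mon_eval v m'"
    by (simp add: mon_eval_superset[of ?A] lookup_add power_add prod.distrib)
  finally show ?thesis .
qed

text \<open>Updating outside the support amounts to adding a single term. Through this induction,
  multiplicativity of \<open>meval\<close> reduces to products of two monomials.\<close>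

lemma poly_mapping_add_single_induct [case_names zero add_single]:
  assumes "P 0"
    and "\<And>f m c. P f \<Longrightarrow> P (f + Poly_Mapping.single m c)"
  shows "P (f :: 'k \<Rightarrow>\<^sub>0 'c::comm_monoid_add)"
proof (induction f rule: update_induct)
  case (update f a b)
  have "Poly_Mapping.update a b f = f + Poly_Mapping.single a b"
    using update.hyps(1)
    by (intro poly_mapping_eqI) (auto simp: lookup_add lookup_update lookup_single when_def in_keys_iff)
  with assms(2)[OF update.IH] show ?case by simp
qed (rule assms(1))

context comm_ring_hom
begin

lemma meval_superset:
  assumes "finite A" "Poly_Mapping.keys P \<subseteq> A"
  shows "meval hom v P = (\<Sum>m\<in>A. hom (Poly_Mapping.lookup P m) * mon_eval v m)"
  unfolding meval_def using assms
  by (intro sum.mono_neutral_left) (auto simp: in_keys_iff)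

lemma meval_0 [simp]: "meval hom v 0 = 0"
  by (simp add: meval_def)

lemma meval_single: "meval hom v (Poly_Mapping.single m c) = hom c * mon_eval v m"
  by (subst meval_superset[of "{m}"]) auto

lemma meval_add: "meval hom v (P + Q) = meval hom v P + meval hom v Q"
proof -
  let ?A = "Poly_Mapping.keys P \<union> Poly_Mapping.keys Q"
  have "meval hom v (P + Q) = (\<Sum>m\<in>?A. hom (Poly_Mapping.lookup (P + Q) m) * mon_eval v m)"
    by (rule meval_superset) (auto simp: in_keys_iff lookup_add)
  then show ?thesis
    by (simp add: meval_superset[of ?A] lookup_add hom_add distrib_right sum.distrib)
qed

lemma meval_mult: "meval hom v (P * Q) = meval hom v P * meval hom v Q"
proof (induction P rule: poly_mapping_add_single_induct)
  case (add_single P m c)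
  have "meval hom v (Poly_Mapping.single m c * Q) = hom c * mon_eval v m * meval hom v Q"
  proof (induction Q rule: poly_mapping_add_single_induct)
    case (add_single Q m' c')
    then show ?case
      by (simp add: distrib_left meval_add mult_single meval_single hom_mult mon_eval_add algebra_simps)
  qed simp
  with add_single show ?case
    by (simp add: distrib_right meval_add meval_single)
qed simp

lemma comm_ring_hom_meval: "comm_ring_hom (meval hom v)"
proof
  show "meval hom v 1 = 1"
    unfolding single_one[symmetric] by (simp add: meval_single del: single_one)
qed (simp_all add: meval_add meval_mult)

lemma meval_mVar [simp]: "meval hom v (mVar i) = v i"
  by (simp add: mVar_def meval_single mon_eval_def)

lemma meval_mConst [simp]: "meval hom v (mConst c) = hom c"
  by (simp add: mConst_def meval_single)

lemma meval_cong:
  assumes "\<And>m i. m \<in> Poly_Mapping.keys P \<Longrightarrow> i \<in> Poly_Mapping.keys m \<Longrightarrow> v i = w i"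
  shows "meval hom v P = meval hom w P"
  using assms unfolding meval_def mon_eval_def by (auto intro!: sum.cong prod.cong)

end

lemma meval_hom_comp:
  assumes "comm_ring_hom k"
  shows "k (meval h v P) = meval (k \<circ> h) (k \<circ> v) P"
proof -
  interpret k: comm_ring_hom k by fact
  show ?thesis
    by (simp add: meval_def mon_eval_def k.hom_sum k.hom_mult k.hom_prod k.hom_power)
qed

lemma meval_mpoly_subst:
  assumes "comm_ring_hom h"
  shows "meval h v (mpoly_subst q P) = meval h (\<lambda>i. meval h v (q i)) P"
proof -
  interpret h: comm_ring_hom h by fact
  show ?thesis
    by (simp add: mpoly_subst_eq_meval meval_hom_comp[OF h.comm_ring_hom_meval] o_def)
qed

text \<open>Reduction modulo \<open>B\<close> isolates the lowest digit; removing it and dividing by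
  \<open>B\<close> gives the induction.\<close>

lemma base_expansion_unique:
  fixes B :: nat
  assumes "(\<Sum>i<N. f i * B ^ i) = (\<Sum>i<N. g i * B ^ i)"
    and "\<And>i. i < N \<Longrightarrow> f i < B" "\<And>i. i < N \<Longrightarrow> g i < B" "j < N"
  shows "f j = g j"
  using assms
proof (induction N arbitrary: f g j)
  case (Suc N)
  have split: "(\<Sum>i<Suc N. f i * B ^ i) = f 0 + B * (\<Sum>i<N. f (Suc i) * B ^ i)" for f :: "nat \<Rightarrow> nat"
    by (subst sum.lessThan_Suc_shift) (simp add: sum_distrib_left algebra_simps)
  from Suc.prems(1) have eq: "f 0 + B * (\<Sum>i<N. f (Suc i) * B ^ i) = g 0 + B * (\<Sum>i<N. g (Suc i) * B ^ i)"
    unfolding split .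
  have "f 0 < B" "g 0 < B" using Suc.prems by auto
  then have "f 0 = g 0" 
    using arg_cong[OF eq, of "\<lambda>x. x mod B"] by simp
  moreover have "(\<Sum>i<N. f (Suc i) * B ^ i) = (\<Sum>i<N. g (Suc i) * B ^ i)"
    using eq \<open>f 0 = g 0\<close> \<open>f 0 < B\<close> by simp
  then have "f (Suc i) = g (Suc i)" if "i < N" for i
    using Suc.IH[of "\<lambda>i. f (Suc i)" "\<lambda>i. g (Suc i)" i] Suc.prems(2,3) that by simp
  ultimately show ?case
    using Suc.prems(4) by (cases j) auto
qed simp

lemma prod_monom_one: "(\<Prod>i\<in>A. monom 1 (f i)) = monom (1::'a::comm_ring_1) (\<Sum>i\<in>A. f i)"
  by (induction A rule: infinite_finite_induct) (auto simp: mult_monom)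

lemma comm_ring_hom_const_poly: "comm_ring_hom (\<lambda>c::'a::comm_ring_1. [:c:])"
  by standard auto

text \<open>Kronecker substitution \<open>x_i = s ^ (B ^ i)\<close> separates the monomials of a given polynomial.\<close>
lemma exists_nonzero_point:
  fixes P :: "'a::field_char_0 mpoly"
  assumes "P \<noteq> 0"
  obtains z where "meval id z P \<noteq> 0"
proof -
  interpret c: comm_ring_hom "\<lambda>c::'a. [:c:]" by (rule comm_ring_hom_const_poly)
  let ?M = "Poly_Mapping.keys P"
  define I where "I = (\<Union>m\<in>?M. Poly_Mapping.keys m)"
  have "finite I" by (simp add: I_def)
  then obtain N where N: "\<And>i. i \<in> I \<Longrightarrow> i < N"
    using finite_nat_set_iff_bounded by auto
  have "finite (\<Union>m\<in>?M. Poly_Mapping.lookup m ` {..<N})" by simp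
  then obtain B where B: "\<And>m i. m \<in> ?M \<Longrightarrow> i < N \<Longrightarrow> Poly_Mapping.lookup m i < B"
    unfolding finite_nat_set_iff_bounded by blast
  \<comment> \<open>\<open>B\<close> exceeds every exponent in \<open>P\<close>, so
    \<open>e m\<close> has the exponents of \<open>m\<close> as its base \<open>B\<close> digits and
    determines \<open>m\<close>.\<close>
  define e where "e m = (\<Sum>i<N. Poly_Mapping.lookup m i * B ^ i)" for m
  have keysN: "Poly_Mapping.keys m \<subseteq> {..<N}" if "m \<in> ?M" for m
    using that N by (auto simp: I_def)
  have inj: "inj_on e ?M"
  proof (rule inj_onI, rule poly_mapping_eqI)
    fix m m' k assume m: "m \<in> ?M" "m' \<in> ?M" "e m = e m'"
    show "Poly_Mapping.lookup m k = Poly_Mapping.lookup m' k"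
    proof (cases "k < N")
      case True
      then show ?thesis
        using base_expansion_unique[of "Poly_Mapping.lookup m" B N "Poly_Mapping.lookup m'" k] m B
        by (simp add: e_def)
    next
      case False
      then show ?thesis using keysN[OF m(1)] keysN[OF m(2)]
        by (metis in_keys_iff lessThan_iff subsetD)
    qed
  qed
  let ?v = "\<lambda>i. monom (1::'a) (B ^ i)"
  have "mon_eval ?v m = monom 1 (e m)" if "m \<in> ?M" for m
    using keysN[OF that]
    by (subst mon_eval_superset[of "{..<N}"])
       (auto simp: e_def monom_power power_mult[symmetric] mult.commute prod_monom_one)
  then have "meval (\<lambda>c. [:c:]) ?v P = (\<Sum>m\<in>?M. monom (Poly_Mapping.lookup P m) (e m))"
    by (simp add: meval_def smult_monom)
  moreover from assms obtain m where m: "m \<in> ?M" by (metis all_not_in_conv keys_eq_empty)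
  have "coeff (\<Sum>m'\<in>?M. monom (Poly_Mapping.lookup P m') (e m')) (e m) = 
      (\<Sum>m'\<in>?M. if m' = m then Poly_Mapping.lookup P m' else 0)"
    unfolding coeff_sum by (intro sum.cong) (use inj m in \<open>auto dest: inj_onD\<close>)
  then have "coeff (\<Sum>m'\<in>?M. monom (Poly_Mapping.lookup P m') (e m')) (e m) \<noteq> 0"
    using m by (simp add: in_keys_iff)
  ultimately have "meval (\<lambda>c. [:c:]) ?v P \<noteq> 0" by auto
  \<comment> \<open>The field is infinite, so a nonzero polynomial in one variable has a
    non-root.\<close>
  then obtain s where s: "poly (meval (\<lambda>c. [:c:]) ?v P) s \<noteq> 0"
    using poly_all_0_iff_0 by blast
  have "comm_ring_hom (\<lambda>p. poly p s)" by standard auto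
  from meval_hom_comp[OF this, of "\<lambda>c. [:c:]" ?v P] s show ?thesis
    by (intro that[of "\<lambda>i. s ^ (B ^ i)"]) (simp add: o_def poly_monom id_def)
qed

subsection \<open>Resultants of binary forms\<close>

lemma sylvester_carrier [simp]: "sylvester d e p q \<in> carrier_mat (d + e) (d + e)"
  by (simp add: sylvester_def)

lemma det_mat_diag: "det (mat_diag n f) = (\<Prod>i<n. f i)"
proof -
  have "det (mat_diag n f) = prod_list (diag_mat (mat_diag n f))"
    by (rule det_upper_triangular[of _ n]) (auto simp: mat_diag_def)
  also have "\<dots> = (\<Prod>i<n. f i)"
    by (simp add: prod_list_diag_prod mat_diag_def atLeast0LessThan)
  finally show ?thesis .
qed

lemma bin_res_dvd:
  fixes p q :: "nat \<Rightarrow> 'r::comm_ring_1"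
  assumes "n \<ge> 1" "q 0 = 0" "q n = c * p n"
  shows "p 0 * p n dvd bin_res n n p q"
proof -
  \<comment> \<open>The first and the last column of the Sylvester matrix are multiples of \<open>p 0\<close> and \<open>p n\<close>.\<close>
  define A where "A = mat (n + n) (n + n) (\<lambda>(i, j).
    if j = 0 then (if i = 0 then 1 else 0)
    else if j = n + n - 1 then (if i = n - 1 then 1 else if i = n + n - 1 then c else 0)
    else sylvester n n p q $$ (i, j))"
  define d where "d j = (if j = 0 then p 0 else if j = n + n - 1 then p n else 1)" for j
  have A: "A \<in> carrier_mat (n + n) (n + n)" by (simp add: A_def)
  have "sylvester n n p q = A * mat_diag (n + n) d"
    unfolding mat_diag_mult_right[OF A]
  proof (rule eq_matI; simp add: sylvester_def, goal_cases)
    case (1 i j)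
    consider "j = 0" | "j = n + n - 1" "j \<noteq> 0" | "j \<noteq> 0" "j \<noteq> n + n - 1" by blast
    then show ?case
    proof cases
      case 1 then show ?thesis using assms \<open>i < n + n\<close>
        by (auto simp: A_def d_def)
    next
      case 2
      \<comment> \<open>Only rows \<open>n - 1\<close> and \<open>n + n - 1\<close> reach the last
        column, with entries \<open>p n\<close> and \<open>q n = c * p n\<close>.\<close>
      have "n + n - 1 - i \<le> n \<longleftrightarrow> i = n - 1" if "i < n" using that assms(1) by linarith
      moreover have "n + n - 1 - (i - n) \<le> n \<longleftrightarrow> i = n + n - 1" if "\<not> i < n" 
        using that assms(1) \<open>i < n + n\<close> by linarith
      ultimately show ?thesis using 2 assms \<open>i < n + n\<close>
        by (auto simp: A_def d_def)
    next
      case 3 then show ?thesis using 1 by (auto simp: A_def d_def sylvester_def)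
    qed
  qed
  then have "bin_res n n p q = det A * (\<Prod>i<n + n. d i)"
    using A by (simp add: bin_res_def det_mult[of _ "n + n"] det_mat_diag)
  also have "(\<Prod>i<n + n. d i) = (\<Prod>i\<in>{0, n + n - 1}. d i)"
    using assms(1) by (intro prod.mono_neutral_right) (auto simp: d_def)
  also have "\<dots> = p 0 * p n"
    using assms(1) by (simp add: d_def)
  finally show ?thesis by simp
qed

text \<open>A row of the Sylvester matrix applied to the vector of powers of \<alpha>; the bound
  \<open>i + d < N\<close> keeps the shifted coefficients from being cut off.\<close>

lemma sum_shifted_coeffs:
  fixes \<alpha> :: "'a::comm_ring_1"
  assumes "i + d < N"
  shows "(\<Sum>j<N. (if i \<le> j \<and> j - i \<le> d then p (j - i) else 0) * \<alpha> ^ j) = \<alpha> ^ i * (\<Sum>k\<le>d. p k * \<alpha> ^ k)"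
proof -
  have "(\<Sum>j<N. (if i \<le> j \<and> j - i \<le> d then p (j - i) else 0) * \<alpha> ^ j) =
      (\<Sum>j\<in>{i..i + d}. p (j - i) * \<alpha> ^ j)"
    using assms by (intro sum.mono_neutral_cong_right) auto
  also have "\<dots> = (\<Sum>k\<le>d. p k * \<alpha> ^ (i + k))"
    by (rule sum.reindex_bij_witness[of _ "\<lambda>k. i + k" "\<lambda>j. j - i"]) auto
  finally show ?thesis
    by (simp add: sum_distrib_left power_add mult_ac)
qed

text \<open>The powers of a common root form a kernel vector of the Sylvester matrix, nonzero
  because its first entry is 1.\<close>

lemma bin_res_common_root:
  fixes \<alpha> :: "'a::idom"
  assumes "(\<Sum>k\<le>d. p k * \<alpha> ^ k) = 0" "(\<Sum>k\<le>e. q k * \<alpha> ^ k) = 0" "d + e > 0"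
  shows "bin_res d e p q = 0"
proof -
  let ?w = "vec (d + e) (\<lambda>j. \<alpha> ^ j)"
  have "sylvester d e p q *\<^sub>v ?w = 0\<^sub>v (d + e)"
  proof (rule eq_vecI)
    fix i assume "i < dim_vec (0\<^sub>v (d + e) :: 'a vec)"
    then have i: "i < d + e" by simp
    then have "(sylvester d e p q *\<^sub>v ?w) $ i = (\<Sum>j<d + e. sylvester d e p q $$ (i, j) * \<alpha> ^ j)"
      by (simp add: scalar_prod_def sylvester_def atLeast0LessThan)
    also have "\<dots> = 0"
    proof (cases "i < e")
      case True
      then show ?thesis
        using assms(1) i sum_shifted_coeffs[of i d "d + e" p \<alpha>] by (simp add: sylvester_def)
    next
      case False
      then show ?thesis
        using assms(2) i sum_shifted_coeffs[of "i - e" e "d + e" q \<alpha>] by (simp add: sylvester_def)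
    qed
    finally show "(sylvester d e p q *\<^sub>v ?w) $ i = 0\<^sub>v (d + e) $ i" using i by simp
  qed (simp add: sylvester_def)
  moreover have "?w \<noteq> 0\<^sub>v (d + e)"
  proof
    assume "?w = 0\<^sub>v (d + e)"
    then have "?w $ 0 = 0\<^sub>v (d + e) $ 0" by (rule arg_cong)
    with assms(3) show False by simp
  qed
  ultimately show ?thesis
    unfolding bin_res_def by (subst det_0_iff_vec_prod_zero[of _ "d + e"]) (auto intro!: exI[of _ ?w])
qed

text \<open>In each Leibniz term only the \<open>d\<close> rows built from \<open>q\<close> can
  contribute to the degree, each at most 1.\<close>

lemma degree_bin_res_le:
  fixes p q :: "nat \<Rightarrow> 'a::comm_ring_1 poly"
  assumes "\<And>k. degree (p k) = 0" "\<And>k. degree (q k) \<le> 1"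
  shows "degree (bin_res d e p q) \<le> d"
  unfolding bin_res_def det_def'[OF sylvester_carrier]
proof (rule degree_sum_le)
  show "finite {\<sigma>. \<sigma> permutes {0..<d + e}}" by (simp add: finite_permutations)
next
  fix \<sigma> assume "\<sigma> \<in> {\<sigma>. \<sigma> permutes {0..<d + e}}"
  then have \<sigma>: "\<sigma> i < d + e" if "i < d + e" for i
    using that permutes_in_image[of \<sigma> "{0..<d + e}" i] by simp
  let ?\<Pi> = "\<Prod>i = 0..<d + e. sylvester d e p q $$ (i, \<sigma> i)"
  have "degree ?\<Pi> \<le> (\<Sum>i = 0..<d + e. degree (sylvester d e p q $$ (i, \<sigma> i)))"
    using degree_prod_sum_le[of "{0..<d + e}" "\<lambda>i. sylvester d e p q $$ (i, \<sigma> i)"] by (simp add: o_def)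
  also have "\<dots> \<le> (\<Sum>i = 0..<d + e. if i < e then 0 else 1)"
    using \<sigma> assms by (intro sum_mono) (auto simp: sylvester_def)
  also have "\<dots> = card {e..<d + e}"
    by (subst sum.mono_neutral_cong_right[of _ "{e..<d + e}" _ "\<lambda>_. 1"]) auto
  finally show "degree (signof \<sigma> * ?\<Pi>) \<le> d"
    by (simp add: sign_def)
qed

lemma bin_res_scale:
  "bin_res d e (\<lambda>k. c * p k) (\<lambda>k. c * q k) = c ^ (d + e) * bin_res d e p q"
proof -
  have "sylvester d e (\<lambda>k. c * p k) (\<lambda>k. c * q k) = c \<cdot>\<^sub>m sylvester d e p q"
    by (rule eq_matI) (auto simp: sylvester_def)
  then show ?thesis
    by (simp add: bin_res_def sylvester_def)
qed

lemma (in comm_ring_hom) hom_bin_res: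
  "hom (bin_res d e p q) = bin_res d e (\<lambda>k. hom (p k)) (\<lambda>k. hom (q k))"
proof -
  have "map_mat hom (sylvester d e p q) = sylvester d e (\<lambda>k. hom (p k)) (\<lambda>k. hom (q k))"
    by (rule eq_matI) (auto simp: sylvester_def)
  then show ?thesis
    by (metis bin_res_def hom_det)
qed

text \<open>When q is a multiple of the pure power of x, the Sylvester matrix is upper
  triangular.\<close>

lemma bin_res_pure_power:
  assumes "\<And>k. k < e \<Longrightarrow> q k = 0"
  shows "bin_res d e p q = p 0 ^ e * q e ^ d"
proof -
  have "bin_res d e p q = prod_list (diag_mat (sylvester d e p q))"
    unfolding bin_res_def
    by (rule det_upper_triangular[of _ "d + e"]) (use assms in \<open>auto simp: sylvester_def upper_triangular_def\<close>)
  also have "\<dots> = (\<Prod>i<d + e. if i < e then p 0 else q e)"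
    by (auto simp: prod_list_diag_prod atLeast0LessThan sylvester_def intro!: prod.cong)
  also have "\<dots> = p 0 ^ e * q e ^ d"
  proof -
    have "{..<d + e} \<inter> {i. i < e} = {..<e}" "{..<d + e} \<inter> - {i. i < e} = {e..<d + e}" by auto
    then show ?thesis by (simp add: prod.If_cases)
  qed
  finally show ?thesis .
qed

subsection \<open>Specialised discriminant-resultants\<close>

lemma mVar_neq_0 [simp]: "mVar i \<noteq> (0 :: 'a::idom mpoly)"
proof -
  interpret id: comm_ring_hom "id :: 'a \<Rightarrow> 'a" by standard auto
  show ?thesis
    using id.meval_mVar[of "\<lambda>_. 1" i] by (metis id.meval_0 zero_neq_one)
qed

text \<open>Discharges the \<open>THE\<close> in \<open>DR\<close>: existence comes from
  \<open>bin_res_dvd\<close>, uniqueness from cancellation in a domain.\<close>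

lemma DR_eq:
  assumes "n \<ge> 1"
  shows "mVar 0 * mVar n * DR n r = coeff (DR_res n :: 'a::idom mpoly poly) r"
proof -
  have "DR_f n 0 * DR_f n n dvd (DR_res n :: 'a mpoly poly)"
    unfolding DR_res_def
    by (rule bin_res_dvd[where c = "[:of_nat n:]"]) (use assms in \<open>auto simp: DR_f_def DR_h_def\<close>)
  then obtain d where "(DR_res n :: 'a mpoly poly) = [:mVar 0 * mVar n:] * d"
    by (auto simp: DR_f_def dvd_def mult.commute)
  then have d: "coeff (DR_res n :: 'a mpoly poly) r = mVar 0 * mVar n * coeff d r" by simp
  have "(mVar 0 * mVar n :: 'a mpoly) \<noteq> 0" by simp
  then have "DR n r = coeff d r"
    unfolding DR_def d by (intro the_equality) (auto simp: mult_left_cancel)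
  then show ?thesis using d by simp
qed

text \<open>\<open>DR_res\<close> with the generic coefficients replaced by \<open>v\<close>. As g
  enters multiplied by x, its coefficient of index \<open>i - 1\<close>, stored at
  \<open>n + 1 + (i - 1) = n + i\<close>, appears at position \<open>i\<close>.\<close>

definition DR_res_at :: "nat \<Rightarrow> (nat \<Rightarrow> 'b::comm_ring_1) \<Rightarrow> 'b poly" where
  "DR_res_at n v = bin_res n n (\<lambda>i. [:v i:])
     (\<lambda>i. [:of_nat i * v i, if 1 \<le> i \<and> i \<le> n - 1 then v (n + i) else 0:])"

lemma meval_DR:
  fixes h :: "'a::idom \<Rightarrow> 'b::comm_ring_1"
  assumes "comm_ring_hom h" "n \<ge> 1"
  shows "v 0 * v n * meval h v (DR n r) = coeff (DR_res_at n v) r"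
proof -
  interpret h: comm_ring_hom h by fact
  interpret m: comm_ring_hom "meval h v" by (rule h.comm_ring_hom_meval)
  interpret mp: map_poly_comm_ring_hom "meval h v" ..
  have "v 0 * v n * meval h v (DR n r) = meval h v (coeff (DR_res n) r)"
    by (simp add: DR_eq[OF assms(2), symmetric] m.hom_mult)
  also have "\<dots> = coeff (map_poly (meval h v) (DR_res n)) r" by simp
  also have "map_poly (meval h v) (DR_res n) = DR_res_at n v"
    unfolding DR_res_def mp.hom_bin_res DR_res_at_def
    by (intro arg_cong2[where f = "bin_res n n"] ext poly_eqI)
       (auto simp: DR_f_def DR_h_def m.hom_mult m.hom_of_nat coeff_map_poly coeff_pCons split: nat.split)
  finally show ?thesis .
qed

lemma poly_DR_res_at:
  "poly (DR_res_at n v) t = bin_res n n v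
     (\<lambda>i. of_nat i * v i + t * (if 1 \<le> i \<and> i \<le> n - 1 then v (n + i) else 0))"
proof -
  have "comm_ring_hom (\<lambda>p. poly p t)" by standard auto
  then show ?thesis
    unfolding DR_res_at_def by (subst comm_ring_hom.hom_bin_res[of "\<lambda>p. poly p t"]) simp_all
qed

lemma degree_DR_res_at_le: "degree (DR_res_at n v) \<le> n"
  unfolding DR_res_at_def by (rule degree_bin_res_le) auto

text \<open>A root repeated in the factorisation into linear factors would also be a root of the
  derivative.\<close>

lemma card_roots_alg_closed:
  fixes p :: "'a::alg_closed_field poly"
  assumes "p \<noteq> 0" "\<And>x. poly p x = 0 \<Longrightarrow> poly (pderiv p) x \<noteq> 0"
  shows "card {x. poly p x = 0} = degree p"
proof -
  obtain A where A: "size A = degree p" "p = smult (lead_coeff p) (\<Prod>x\<in>#A. [:-x, 1:])"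
    using alg_closed_imp_factorization[OF assms(1)] by blast
  have roots: "{x. poly p x = 0} = set_mset A"
    using assms(1) by (subst A(2)) (auto simp: poly_prod_mset prod_mset_zero_iff)
  have "count A x = 1" if "x \<in># A" for x
  proof (rule ccontr)
    assume "count A x \<noteq> 1"
    moreover from that have "count A x > 0" by simp
    ultimately have "count A x \<ge> 2" by linarith
    then have "{#x, x#} \<subseteq># A"
      by (intro mset_subset_eqI) auto
    then obtain B where "A = {#x, x#} + B"
      by (auto simp: mset_subset_eq_exists_conv)
    then obtain g where g: "p = [:-x, 1:] * ([:-x, 1:] * g)"
      using A(2) by (intro that[of "smult (lead_coeff p) (\<Prod>x\<in>#B. [:-x, 1:])"]) simp
    have "poly (pderiv p) x = 0"
      unfolding g pderiv_mult by simp
    with assms(2)[of x] g show False by simp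
  qed
  then have "size A = card (set_mset A)"
    by (simp add: size_multiset_overloaded_eq)
  then show ?thesis using A roots by simp
qed

text \<open>Here \<open>g\<close> is \<open>- \<partial>\<^sub>y f / y\<close>. Both sides are polynomials in the variable \<open>t\<close> of degree at most \<open>n\<close>
  which agree at \<open>0\<close> and vanish at \<open>-1/\<alpha>\<close> for each of the \<open>n\<close> roots \<open>\<alpha>\<close> of \<open>f\<close>.\<close>
lemma DR_res_at_polar:
  fixes n :: nat and a v :: "nat \<Rightarrow> 'b::alg_closed_field"
  defines "D \<equiv> bin_res n n a (\<lambda>i. of_nat i * a i)"
  assumes n: "n \<ge> 2" and an1: "a (n - 1) = 0" and D: "D \<noteq> 0"
    and v: "\<And>i. i \<le> n \<Longrightarrow> v i = a i"
    and b: "\<And>i. 1 \<le> i \<Longrightarrow> i \<le> n - 1 \<Longrightarrow> v (n + i) = - of_nat (n - (i - 1)) * a (i - 1)"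
    and r: "r \<le> n"
  shows "a n * coeff (DR_res_at n v) r = D * (-1) ^ r * a (n - r)"
proof -
  define H where "H t i = of_nat i * v i + t * (if 1 \<le> i \<and> i \<le> n - 1 then v (n + i) else 0)" for t i
  have dvd: "a 0 * a n dvd D"
    unfolding D_def using n by (intro bin_res_dvd[where c = "of_nat n"]) auto
  then have a0: "a 0 \<noteq> 0" and an: "a n \<noteq> 0" using D by auto
  have D': "bin_res n n v (\<lambda>i. of_nat i * v i) = D"
    unfolding D_def bin_res_def sylvester_def
    by (intro arg_cong[where f = det] eq_matI) (auto simp: v)
  \<comment> \<open>By Euler's identity, x f' + y \<partial>f/\<partial>y = n f, the choice of g
    gives x g = x (x f') - n x f at y = 1.\<close>
  have sumH: "(\<Sum>i\<le>n. H t i * \<alpha> ^ i) =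
      (1 + t * \<alpha>) * (\<Sum>i\<le>n. of_nat i * a i * \<alpha> ^ i) - of_nat n * t * \<alpha> * (\<Sum>i\<le>n. a i * \<alpha> ^ i)" for t \<alpha>
  proof -
    have "(\<Sum>i\<le>n. (if 1 \<le> i \<and> i \<le> n - 1 then v (n + i) else 0) * \<alpha> ^ i) =
        (\<Sum>i\<in>{1..n - 1}. - of_nat (n - (i - 1)) * a (i - 1) * \<alpha> ^ i)"
      using b by (intro sum.mono_neutral_cong_right) (auto simp del: of_nat_diff)
    also have "\<dots> = (\<Sum>i<n - 1. - of_nat (n - i) * a i * \<alpha> ^ Suc i)"
      by (rule sum.reindex_bij_witness[of _ Suc "\<lambda>i. i - 1"]) (use n in auto)
    also have "\<dots> = (\<Sum>i\<le>n. - of_nat (n - i) * a i * \<alpha> ^ Suc i)"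
    proof (rule sum.mono_neutral_left)
      \<comment> \<open>The two added terms vanish: \<open>i = n - 1\<close> because
        \<open>a (n - 1) = 0\<close>, and \<open>i = n\<close> because of the factor
        \<open>n - i\<close>.\<close>
      show "\<forall>i\<in>{..n} - {..<n - 1}. - of_nat (n - i) * a i * \<alpha> ^ Suc i = 0"
      proof
        fix i assume "i \<in> {..n} - {..<n - 1}"
        then have "i = n - 1 \<or> i = n" by auto
        then show "- of_nat (n - i) * a i * \<alpha> ^ Suc i = 0" using an1 by auto
      qed
    qed auto
    also have "\<dots> = \<alpha> * (\<Sum>i\<le>n. of_nat i * a i * \<alpha> ^ i) - of_nat n * \<alpha> * (\<Sum>i\<le>n. a i * \<alpha> ^ i)"
      by (simp add: sum_distrib_left flip: sum_subtractf) (intro sum.cong, auto simp: of_nat_diff algebra_simps)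
    finally have *: "(\<Sum>i\<le>n. (if 1 \<le> i \<and> i \<le> n - 1 then v (n + i) else 0) * \<alpha> ^ i) = \<dots>" .
    have "(\<Sum>i\<le>n. H t i * \<alpha> ^ i) = (\<Sum>i\<le>n. of_nat i * a i * \<alpha> ^ i) +
        t * (\<Sum>i\<le>n. (if 1 \<le> i \<and> i \<le> n - 1 then v (n + i) else 0) * \<alpha> ^ i)"
      unfolding sum_distrib_left sum.distrib[symmetric]
      by (intro sum.cong) (auto simp: H_def v algebra_simps)
    then show ?thesis unfolding * by (simp add: algebra_simps)
  qed
  have root: "poly (DR_res_at n v) t = 0" if "(\<Sum>i\<le>n. a i * \<alpha> ^ i) = 0" "1 + t * \<alpha> = 0" for t \<alpha>
    unfolding poly_DR_res_at H_def[symmetric]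
    by (rule bin_res_common_root[where \<alpha> = \<alpha>]) (use that n v sumH in auto)
  define f where "f = (\<Sum>k\<le>n. monom (a k) k)"
  have coeff_f: "coeff f k = (if k \<le> n then a k else 0)" for k
    by (simp add: f_def coeff_sum)
  have deg_f: "degree f = n"
    by (intro antisym degree_le le_degree) (auto simp: coeff_f an)
  have poly_f: "poly f \<alpha> = (\<Sum>k\<le>n. a k * \<alpha> ^ k)" for \<alpha>
    by (simp add: f_def poly_sum poly_monom)
  have pderiv_f: "\<alpha> * poly (pderiv f) \<alpha> = (\<Sum>k\<le>n. of_nat k * a k * \<alpha> ^ k)" for \<alpha>
  proof -
    have "\<alpha> * poly (pderiv f) \<alpha> = (\<Sum>k\<le>n. \<alpha> * (of_nat k * a k * \<alpha> ^ (k - 1)))"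
      by (simp add: f_def higher_pderiv_sum pderiv_sum poly_sum pderiv_monom poly_monom sum_distrib_left)
    also have "\<dots> = (\<Sum>k\<le>n. of_nat k * a k * \<alpha> ^ k)"
    proof (rule sum.cong)
      fix k show "\<alpha> * (of_nat k * a k * \<alpha> ^ (k - 1)) = of_nat k * a k * \<alpha> ^ k"
        by (cases k) (auto simp: mult_ac)
    qed simp
    finally show ?thesis .
  qed
  have card: "card {\<alpha>. poly f \<alpha> = 0} = n"
  proof -
    \<comment> \<open>A multiple root would be common to f and x f', whose resultant is
      \<open>D\<close>.\<close>
    have "poly (pderiv f) \<alpha> \<noteq> 0" if "poly f \<alpha> = 0" for \<alpha>
    proof
      assume "poly (pderiv f) \<alpha> = 0"
      then have "D = 0"
        unfolding D_def using that n pderiv_f[of \<alpha>]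
        by (intro bin_res_common_root[where \<alpha> = \<alpha>]) (auto simp: poly_f)
      with D show False ..
    qed
    then show ?thesis
      using card_roots_alg_closed[of f] deg_f n by (metis degree_0 not_numeral_le_zero)
  qed
  have nz: "\<alpha> \<noteq> 0" if "poly f \<alpha> = 0" for \<alpha>
    using that a0 by (auto simp: poly_0_coeff_0 coeff_f)
  \<comment> \<open>This is (-t)^n f(-1/t), so its zeros come from the roots of f; its constant term
    is \<open>a n\<close>.\<close>
  define G where "G = (\<Sum>r\<le>n. monom ((-1) ^ r * a (n - r)) r)"
  have coeff_G: "coeff G r = (if r \<le> n then (-1) ^ r * a (n - r) else 0)" for r
    by (simp add: G_def coeff_sum)
  have G_root: "poly G (- inverse \<alpha>) = 0" if "poly f \<alpha> = 0" for \<alpha>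
  proof -
    have "\<alpha> ^ n * poly G (- inverse \<alpha>) = (\<Sum>r\<le>n. a (n - r) * \<alpha> ^ (n - r))"
      unfolding G_def poly_sum poly_monom sum_distrib_left
    proof (rule sum.cong)
      fix r assume "r \<in> {..n}"
      then have "\<alpha> ^ n = \<alpha> ^ (n - r) * \<alpha> ^ r" by (simp flip: power_add)
      moreover have "(-1) ^ r * (- inverse \<alpha>) ^ r = inverse (\<alpha> ^ r)"
        by (simp flip: power_mult_distrib power_inverse)
      ultimately show "\<alpha> ^ n * ((-1) ^ r * a (n - r) * (- inverse \<alpha>) ^ r) = a (n - r) * \<alpha> ^ (n - r)"
        using nz[OF that] by (simp add: field_simps)
    qed simp
    also have "\<dots> = poly f \<alpha>"
      unfolding poly_f by (rule sum.reindex_bij_witness[of _ "\<lambda>i. n - i" "\<lambda>i. n - i"]) auto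
    finally show ?thesis using that nz by simp
  qed
  define E where "E = smult (a n) (DR_res_at n v) - smult D G"
  have "E = 0"
  proof (rule ccontr)
    assume "E \<noteq> 0"
    have "degree E \<le> n"
      unfolding E_def using degree_DR_res_at_le[of n v]
      by (intro degree_diff_le order.trans[OF degree_smult_le] degree_le) (auto simp: coeff_G coeff_eq_0)
    let ?T = "insert 0 ((\<lambda>\<alpha>. - inverse \<alpha>) ` {\<alpha>. poly f \<alpha> = 0})"
    have "poly E 0 = 0"
      using D' poly_0_coeff_0[of G] by (simp add: E_def poly_DR_res_at coeff_G del: poly_0_coeff_0)
    moreover have "poly E (- inverse \<alpha>) = 0" if "poly f \<alpha> = 0" for \<alpha>
      using root[of \<alpha> "- inverse \<alpha>"] G_root[OF that] nz[OF that] that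
      by (simp add: E_def poly_f)
    ultimately have "?T \<subseteq> {t. poly E t = 0}" by auto
    then have "card ?T \<le> card {t. poly E t = 0}"
      using poly_roots_finite[OF \<open>E \<noteq> 0\<close>] by (intro card_mono)
    also have "\<dots> \<le> n"
      using poly_roots_degree[OF \<open>E \<noteq> 0\<close>] \<open>degree E \<le> n\<close> by linarith
    finally have "card ?T \<le> n" .
    moreover have "finite {\<alpha>. poly f \<alpha> = 0}"
      using card n by (intro card_ge_0_finite) auto
    then have "card ?T = Suc (card ((\<lambda>\<alpha>. - inverse \<alpha>) ` {\<alpha>. poly f \<alpha> = 0}))"
      using nz by (subst card_insert_disjoint) auto
    moreover have "card ((\<lambda>\<alpha>. - inverse \<alpha>) ` {\<alpha>. poly f \<alpha> = 0}) = n"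
      using card by (subst card_image) (auto intro!: inj_onI)
    ultimately show False by simp
  qed
  then have "coeff E r = 0" by simp
  then show ?thesis using r by (simp add: E_def coeff_G)
qed

subsection \<open>Algebraic independence\<close>

text \<open>Coefficients of the form \<open>f\<close> on which \<open>DR\<^sub>0\<close> and \<open>DR\<^sub>r\<close>, up to rescaling \<open>f\<close>, take the
  values \<open>z\<^sub>0\<close> and \<open>z\<^bsub>r-1\<^esub>\<close>.\<close>
definition target_coeff :: "nat \<Rightarrow> (nat \<Rightarrow> 'b::comm_ring_1) \<Rightarrow> nat \<Rightarrow> 'b" where
  "target_coeff n z i =
     (if i = n then z 0 else if i = n - 1 then 0 else (-1) ^ (n - i) * z (n - i - 1))"

text \<open>The resultant of f and x f' for the target form, that is, its discriminant times both
  end coefficients. With variables for \<open>z\<close> it becomes the excluded polynomial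
  \<open>Q\<close>.\<close>

definition target_res :: "nat \<Rightarrow> (nat \<Rightarrow> 'b::comm_ring_1) \<Rightarrow> 'b" where
  "target_res n z = bin_res n n (target_coeff n z) (\<lambda>i. of_nat i * target_coeff n z i)"

lemma (in comm_ring_hom) hom_target_res: "hom (target_res n z) = target_res n (\<lambda>i. hom (z i))"
proof -
  have "hom (target_coeff n z i) = target_coeff n (\<lambda>i. hom (z i)) i" for i
    by (simp add: target_coeff_def hom_mult hom_power hom_uminus)
  then show ?thesis
    by (simp add: target_res_def hom_bin_res hom_mult hom_of_nat)
qed

text \<open>The chosen \<open>z\<close> yields the form x^n + (-1)^n y^n. Here x f' is n x^n, so the
  resultant is, up to sign, n^n, nonzero in characteristic zero.\<close>

lemma target_res_nonzero:
  assumes "n \<ge> 2"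
  shows "target_res n (\<lambda>i. if i = 0 \<or> i = n - 1 then 1 else 0 :: 'a::field_char_0) \<noteq> 0"
proof -
  have "of_nat k * target_coeff n (\<lambda>i. if i = 0 \<or> i = n - 1 then 1 else 0 :: 'a) k = 0" if "k < n" for k
    using that by (cases "k = 0") (auto simp: target_coeff_def)
  then show ?thesis
    unfolding target_res_def using assms
    by (subst bin_res_pure_power) (auto simp: target_coeff_def)
qed

text \<open>Once the target form is scaled so that its \<open>DR n 0\<close> equals the unscaled
  \<open>a n\<close>, the polar formula reads \<open>DR n r = (-1) ^ r * a (n - r)\<close>, and the
  target coefficients invert this.\<close>

lemma exists_DR_preimage:
  fixes z :: "nat \<Rightarrow> 'b::alg_closed_field" and h :: "'a::idom \<Rightarrow> 'b"
  assumes h: "comm_ring_hom h" and n: "n \<ge> 2" and nz: "target_res n z \<noteq> 0"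
  obtains v where "\<And>i. i < n \<Longrightarrow> meval h v (DR n (if i = 0 then 0 else i + 1)) = z i"
proof -
  define a where "a = target_coeff n z"
  define D where "D = bin_res n n a (\<lambda>i. of_nat i * a i)"
  have "D \<noteq> 0" using nz by (simp add: D_def a_def target_res_def)
  have "a 0 * a n dvd D"
    unfolding D_def using n by (intro bin_res_dvd[where c = "of_nat n"]) auto
  then have a0: "a 0 \<noteq> 0" and an: "a n \<noteq> 0" using \<open>D \<noteq> 0\<close> by auto
  have "2 * n - 2 > 0" using n by simp
  \<comment> \<open>Scaling f by \<open>c\<close> multiplies the resultant by
    \<open>c ^ (2 * n)\<close> and the product of the end coefficients by \<open>c ^ 2\<close>,
    hence \<open>DR n 0\<close> by \<open>c ^ (2 * n - 2)\<close>.\<close>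
  then obtain c where c: "c ^ (2 * n - 2) = a n * (a 0 * a n) / D"
    using nth_root_exists by blast
  have "c \<noteq> 0" using c a0 an \<open>D \<noteq> 0\<close> \<open>2 * n - 2 > 0\<close> by (auto simp: power_0_left)
  have "2 * n = (2 * n - 2) + 2" using n by simp
  then have "c ^ (2 * n) = c ^ (2 * n - 2) * c ^ 2" by (metis power_add)
  then have cD: "c ^ (2 * n) * D = c ^ 2 * (a n * (a 0 * a n))"
    using c \<open>D \<noteq> 0\<close> by simp
  \<comment> \<open>For \<open>k > n\<close> these are the coefficients of g, minus the y-derivative
    of the scaled form divided by y.\<close>
  define v where "v k = (if k \<le> n then c * a k else - of_nat (n - (k - n - 1)) * (c * a (k - n - 1)))" for k
  have scaled: "bin_res n n (\<lambda>i. c * a i) (\<lambda>i. of_nat i * (c * a i)) = c ^ (2 * n) * D"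
    using bin_res_scale[of n n c a "\<lambda>i. of_nat i * a i"] by (simp add: D_def mult_2 mult.left_commute[of _ c])
  have DR: "meval h v (DR n r) = (-1) ^ r * a (n - r)" if "r \<le> n" for r
  proof -
    have "c * a n * coeff (DR_res_at n v) r =
        bin_res n n (\<lambda>i. c * a i) (\<lambda>i. of_nat i * (c * a i)) * (-1) ^ r * (c * a (n - r))"
    proof (rule DR_res_at_polar[OF n])
      show "c * a (n - 1) = 0" using n by (simp add: a_def target_coeff_def)
      show "bin_res n n (\<lambda>i. c * a i) (\<lambda>i. of_nat i * (c * a i)) \<noteq> 0"
        using \<open>c \<noteq> 0\<close> \<open>D \<noteq> 0\<close> by (simp add: scaled)
      show "v (n + i) = - of_nat (n - (i - 1)) * (c * a (i - 1))" if "1 \<le> i" "i \<le> n - 1" for i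
        using that by (simp add: v_def)
    qed (use that in \<open>auto simp: v_def\<close>)
    also have "\<dots> = c ^ 2 * (a n * (a 0 * a n)) * (-1) ^ r * (c * a (n - r))"
      by (simp add: scaled cD)
    finally have "coeff (DR_res_at n v) r = c ^ 2 * (a 0 * a n) * ((-1) ^ r * a (n - r))"
      using \<open>c \<noteq> 0\<close> an by (simp add: field_simps)
    moreover have "v 0 * v n * meval h v (DR n r) = coeff (DR_res_at n v) r"
      using meval_DR[OF h] n by simp
    moreover have "v 0 * v n = c ^ 2 * (a 0 * a n)"
      by (simp add: v_def power2_eq_square mult_ac)
    ultimately show ?thesis
      using \<open>c \<noteq> 0\<close> a0 an by simp
  qed
  have "meval h v (DR n (if i = 0 then 0 else i + 1)) = z i" if "i < n" for i
    using that by (cases "i = 0") (auto simp: DR a_def target_coeff_def simp flip: power_mult_distrib mult.assoc)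
  then show thesis by (rule that)
qed

theorem theorem5p1:
  fixes n :: nat
  assumes "n \<ge> 2"
  shows "alg_indep (\<lambda>i. (DR n (if i = 0 then 0 else i + 1) :: 'a::field_char_0 mpoly)) n"
  unfolding alg_indep_def
proof (intro allI impI, rule ccontr)
  fix P :: "'a mpoly"
  let ?q = "\<lambda>i. DR n (if i = 0 then 0 else i + 1) :: 'a mpoly"
  assume keys: "\<forall>m\<in>Poly_Mapping.keys P. Poly_Mapping.keys m \<subseteq> {..<n}"
    and rel: "mpoly_subst ?q P = 0" and "P \<noteq> 0"
  interpret id: comm_ring_hom "id :: 'a \<Rightarrow> 'a" by standard auto
  \<comment> \<open>The point \<open>z\<close> is found over the base field; only its preimage,
    which needs a root of order \<open>2 * n - 2\<close> and the roots of f, lives in the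
    closure.\<close>
  interpret ac: comm_ring_hom "to_ac :: 'a \<Rightarrow> 'a alg_closure" by standard auto
  have ev: "comm_ring_hom (meval id z :: 'a mpoly \<Rightarrow> 'a)" for z by (rule id.comm_ring_hom_meval)
  define Q :: "'a mpoly" where "Q = target_res n mVar"
  have Q: "meval id z Q = target_res n z" for z :: "nat \<Rightarrow> 'a"
    unfolding Q_def using comm_ring_hom.hom_target_res[OF ev, of z n mVar] by simp
  have "Q \<noteq> 0"
    using Q target_res_nonzero[OF assms, where 'a = 'a] by fastforce
  then have "P * Q \<noteq> 0" using \<open>P \<noteq> 0\<close> by simp
  then obtain z where "meval id z (P * Q) \<noteq> 0"
    by (rule exists_nonzero_point)
  then have zP: "meval id z P \<noteq> 0" and zQ: "target_res n z \<noteq> 0"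
    by (auto simp: id.meval_mult Q)
  have "target_res n (\<lambda>i. to_ac (z i)) \<noteq> 0"
    using zQ by (simp flip: ac.hom_target_res)
  then obtain v where v: "\<And>i. i < n \<Longrightarrow> meval to_ac v (?q i) = to_ac (z i)"
    using exists_DR_preimage[OF ac.comm_ring_hom_axioms assms, of "\<lambda>i. to_ac (z i)"] by metis
  have "0 = meval to_ac v (mpoly_subst ?q P)" by (simp add: rel)
  also have "\<dots> = meval to_ac (\<lambda>i. meval to_ac v (?q i)) P"
    by (rule meval_mpoly_subst[OF ac.comm_ring_hom_axioms])
  \<comment> \<open>The values are prescribed only for \<open>i < n\<close>, which covers all
    variables of \<open>P\<close>.\<close>
  also have "\<dots> = meval to_ac (\<lambda>i. to_ac (z i)) P"
    using keys v by (intro ac.meval_cong) blast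
  also have "\<dots> = to_ac (meval id z P)"
    by (simp add: meval_hom_comp[OF ac.comm_ring_hom_axioms] o_def id_def)
  finally show False using zP by simp
qed

end
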